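(* Consider the RBCD method with the discrepancy principle, with $\tau>1$ and $\gamma=\mu/\|A\|^2$ for some $0<\mu<2$. Then the iteration terminates in finitely many steps almost surely, i.e. almost surely there is a finite integer $k\ge 0$ with $\|Ax_k^\delta-y^\delta\|\le\tau\delta$. If in addition $0<\mu<2-2/\tau$, then for any solution $\bar x$ of $Ax=y$ there holds $$\mathbb E\big[\|x_{k+1}^\delta-\bar x\|^2\big]\le\mathbb E\big[\|x_k^\delta-\bar x\|^2\big]-c_1\,\mathbb E\big[\gamma_k\|Ax_k^\delta-y^\delta\|^2\big]$$ for all integers $k\ge0$, where $c_1:=(2-2/\tau-\mu)/b>0$.
   Context: Let $b\ge1$, let $X_1,\dots,X_b$ and $\mathcal Y$ be real Hilbert spaces, and let $A_i:X_i\to\mathcal Y$ be bounded linear operators with adjoints $A_i^*$. Let $\mathcal X:=X_1\times\cdots\times X_b$ with the natural product inner product and define $A:\mathcal X\to\mathcal Y$, $Ax:=\sum_{i=1}^bA_ix_i$ for $x=(x_1,\dots,x_b)$. It is assumed that $y\in\mathrm{Ran}(A)$, and $y^\delta\in\mathcal Y$ is noisy data with $\|y^\delta-y\|\le\delta$, where $\delta>0$. RBCD method with the discrepancy principle: let $i_0,i_1,i_2,\dots$ be independent random indices, each uniformly distributed on $\{1,\dots,b\}$. Pick $x_0\in\mathcal X$, $x_0^\delta:=x_0$, $\tau>1$, $\gamma>0$. For $k\ge0$ let $r_k^\delta:=Ax_k^\delta-y^\delta$, set $\gamma_k:=\gamma$ if $\|r_k^\delta\|>\tau\delta$ and $\gamma_k:=0$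 if $\|r_k^\delta\|\le\tau\delta$, and define $x_{k+1,i}^\delta=x_{k,i}^\delta$ for $i\neq i_k$ and $x_{k+1,i_k}^\delta=x_{k,i_k}^\delta-\gamma_kA_{i_k}^*r_k^\delta$. $\mathbb E$ denotes expectation with respect to the random indices. *)

theory Defs
  imports "HOL-Probability.Probability"
begin

text \<open>
  The spaces \<open>X\<^sub>1, \<dots>, X\<^sub>b\<close> may differ from one another.  They are modelled as complete linear
  subspaces \<open>X i\<close> of one real inner product type (for arbitrary Hilbert spaces, take their direct
  sum), indexed by a finite type \<open>'n\<close> with \<open>b = CARD('n)\<close>.  The product space is a subspace of
  \<open>'x ^ 'n\<close>, whose library inner product is the sum of the inner products of the components.  The
  values of the operators outside their domains are irrelevant.
\<close>

definition hilbert_subspace :: "'x::real_inner set \<Rightarrow> bool" where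
  "hilbert_subspace S \<longleftrightarrow> subspace S \<and> Topological_Spaces.complete S"

definition bounded_linear_on :: "'x::real_normed_vector set \<Rightarrow> ('x \<Rightarrow> 'y::real_normed_vector) \<Rightarrow> bool" where
  "bounded_linear_on S f \<longleftrightarrow>
     (\<forall>u\<in>S. \<forall>v\<in>S. f (u + v) = f u + f v) \<and>
     (\<forall>c. \<forall>u\<in>S. f (c *\<^sub>R u) = c *\<^sub>R f u) \<and>
     (\<exists>K. \<forall>u\<in>S. norm (f u) \<le> norm u * K)"

text \<open>As \<^const>\<open>onorm\<close>, but with the supremum over \<open>S\<close> only.\<close>

definition onorm_on :: "'x::real_normed_vector set \<Rightarrow> ('x \<Rightarrow> 'y::real_normed_vector) \<Rightarrow> real" where
  "onorm_on S f = (SUP u\<in>S. norm (f u) / norm u)"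

text \<open>
  The Hilbert space adjoint of \<open>f : S \<rightarrow> Y\<close>.  For complete \<open>S\<close> and bounded linear \<open>f\<close> the described
  element exists and is unique by the Riesz representation theorem.
\<close>

definition adjoint_on :: "'x::real_inner set \<Rightarrow> ('x \<Rightarrow> 'y::real_inner) \<Rightarrow> 'y \<Rightarrow> 'x" where
  "adjoint_on S f w = (THE z. z \<in> S \<and> (\<forall>u\<in>S. f u \<bullet> w = u \<bullet> z))"

definition block_space :: "('n \<Rightarrow> 'x set) \<Rightarrow> ('x ^ 'n) set" where
  "block_space X = {x. \<forall>i. x $ i \<in> X i}"

definition block_op :: "('n::finite \<Rightarrow> 'x \<Rightarrow> 'y::comm_monoid_add) \<Rightarrow> 'x ^ 'n \<Rightarrow> 'y" where
  "block_op A x = (\<Sum>i\<in>UNIV. A i (x $ i))"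

definition discrepancy_step :: "real \<Rightarrow> real \<Rightarrow> real \<Rightarrow> 'y::real_normed_vector \<Rightarrow> real" where
  "discrepancy_step \<gamma> \<tau> \<delta> r = (if norm r > \<tau> * \<delta> then \<gamma> else 0)"

definition rbcd_step ::
  "('n::finite \<Rightarrow> 'x::real_inner set) \<Rightarrow> ('n \<Rightarrow> 'x \<Rightarrow> 'y::real_inner) \<Rightarrow> 'y
    \<Rightarrow> real \<Rightarrow> real \<Rightarrow> real \<Rightarrow> 'n \<Rightarrow> 'x ^ 'n \<Rightarrow> 'x ^ 'n" where
  "rbcd_step X A y\<^sub>\<delta> \<gamma> \<tau> \<delta> j x =
     (let r = block_op A x - y\<^sub>\<delta>
      in \<chi> i. if i = j then x $ i - discrepancy_step \<gamma> \<tau> \<delta> r *\<^sub>R adjoint_on (X i) (A i) r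
              else x $ i)"

text \<open>The iterates for one realization \<open>j\<^sub>0, j\<^sub>1, \<dots>\<close> of the random indices.\<close>

primrec rbcd ::
  "('n::finite \<Rightarrow> 'x::real_inner set) \<Rightarrow> ('n \<Rightarrow> 'x \<Rightarrow> 'y::real_inner) \<Rightarrow> 'y
    \<Rightarrow> real \<Rightarrow> real \<Rightarrow> real \<Rightarrow> 'x ^ 'n \<Rightarrow> (nat \<Rightarrow> 'n) \<Rightarrow> nat \<Rightarrow> 'x ^ 'n" where
  "rbcd X A y\<^sub>\<delta> \<gamma> \<tau> \<delta> x\<^sub>0 j 0 = x\<^sub>0"
| "rbcd X A y\<^sub>\<delta> \<gamma> \<tau> \<delta> x\<^sub>0 j (Suc k) =
     rbcd_step X A y\<^sub>\<delta> \<gamma> \<tau> \<delta> (j k) (rbcd X A y\<^sub>\<delta> \<gamma> \<tau> \<delta> x\<^sub>0 j k)"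

end

theory Submission
  imports Defs
begin

text \<open>
  Averaging the squared error after one step over the chosen block gives the descent inequality,
  because \<open>\<langle>A\<^sup>* r, x - xbar\<rangle> \<ge> \<parallel>r\<parallel>\<^sup>2 - \<delta> \<parallel>r\<parallel>\<close>.

  For \<open>\<mu>\<close> between \<open>2 - 2 / \<tau>\<close> and \<open>2\<close> the error need not decrease on average, so termination rests on
  the residual: it decreases along every path, and on average by at least a multiple of
  \<open>\<gamma>\<^sub>k \<parallel>A\<^sup>* r\<^sub>k\<parallel>\<^sup>2\<close>.  Without termination, \<open>\<parallel>A\<^sup>* r\<^sub>k\<parallel> \<parallel>x\<^sub>k - xbar\<parallel>\<close> is bounded below and
  \<open>\<parallel>x\<^sub>k - xbar\<parallel>\<^sup>2 = O(k)\<close>, so \<open>\<parallel>A\<^sup>* r\<^sub>k\<parallel>\<^sup>2\<close> is at least a multiple of \<open>1 / k\<close>.  As the harmonic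
  series diverges, this happens with probability zero.
\<close>

subsection \<open>Riesz representation and adjoints on complete subspaces\<close>

lemma bounded_linear_onD:
  assumes "bounded_linear_on S f" "u \<in> S"
  shows "v \<in> S \<Longrightarrow> f (u + v) = f u + f v" "f (c *\<^sub>R u) = c *\<^sub>R f u"
  using assms unfolding bounded_linear_on_def by auto

lemma bounded_linear_on_diff:
  assumes f: "bounded_linear_on S f" and S: "subspace S" and u: "u \<in> S" and v: "v \<in> S"
  shows "f (u - v) = f u - f v"
proof -
  have "f (u + (-1) *\<^sub>R v) = f u + f ((-1) *\<^sub>R v)"
    by (rule bounded_linear_onD(1)[OF f u]) (rule subspace_scale[OF S v])
  then show ?thesis
    by (simp only: bounded_linear_onD(2)[OF f v]) simp
qed

lemma bounded_linear_on_pos_bound: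
  assumes "bounded_linear_on S f"
  obtains K where "K > 0" "\<And>u. u \<in> S \<Longrightarrow> norm (f u) \<le> norm u * K"
proof -
  obtain K where K: "\<And>u. u \<in> S \<Longrightarrow> norm (f u) \<le> norm u * K"
    using assms unfolding bounded_linear_on_def by blast
  show ?thesis
  proof (rule that[of "max K 1"])
    show "norm (f u) \<le> norm u * max K 1" if "u \<in> S" for u
      using K[OF that] mult_left_mono[of K "max K 1" "norm u"] by simp
  qed simp
qed

text \<open>The representing vector minimises \<open>\<parallel>u\<parallel>\<^sup>2 / 2 - \<phi> u\<close> over \<open>S\<close>; minimising sequences are Cauchy by the
  parallelogram identity.\<close>

theorem riesz_representation_on:
  fixes S :: "'a::real_inner set" and \<phi> :: "'a \<Rightarrow> real"
  assumes S: "hilbert_subspace S" and \<phi>: "bounded_linear_on S \<phi>"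
  obtains z where "z \<in> S" "\<And>u. u \<in> S \<Longrightarrow> \<phi> u = u \<bullet> z"
proof -
  have sub: "subspace S" and comp: "Topological_Spaces.complete S"
    using S by (auto simp: hilbert_subspace_def)
  obtain K where K0: "K > 0" and K: "\<And>u. u \<in> S \<Longrightarrow> norm (\<phi> u) \<le> norm u * K"
    using bounded_linear_on_pos_bound[OF \<phi>] by blast
  define F where "F u = (u \<bullet> u) / 2 - \<phi> u" for u
  have lower: "F u \<ge> - (K\<^sup>2 / 2)" if "u \<in> S" for u
  proof -
    have "(norm u - K)\<^sup>2 \<ge> 0" by simp
    then show ?thesis
      using K[OF that] by (simp add: F_def power2_eq_square algebra_simps flip: power2_norm_eq_inner)
  qed
  have bdd: "bdd_below (F ` S)"
    using lower by (auto intro!: bdd_belowI)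
  have S0: "0 \<in> S" by (rule subspace_0[OF sub])
  define m where "m = Inf (F ` S)"
  have m: "m \<le> F u" if "u \<in> S" for u
    unfolding m_def using bdd that by (auto intro: cInf_lower)
  have "\<exists>u\<in>S. F u < m + 1 / real (Suc n)" for n
  proof -
    have "Inf (F ` S) < m + 1 / real (Suc n)" by (simp add: m_def)
    then show ?thesis
      using cInf_less_iff[of "F ` S"] bdd S0 by blast
  qed
  then obtain s where s: "\<And>n. s n \<in> S" and sF: "\<And>n. F (s n) < m + 1 / real (Suc n)"
    by metis
  have par: "(norm (u - v))\<^sup>2 \<le> 4 * (F u - m) + 4 * (F v - m)" if u: "u \<in> S" and v: "v \<in> S" for u v
  proof -
    define w where "w = (1/2) *\<^sub>R (u + v)"
    have w: "w \<in> S"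
      unfolding w_def by (intro subspace_scale[OF sub] subspace_add[OF sub] u v)
    have "\<phi> w = (\<phi> u + \<phi> v) / 2"
      using bounded_linear_onD[OF \<phi>] u v subspace_add[OF sub] by (simp add: w_def del: scaleR_add_right)
    moreover have "w \<bullet> w = (u \<bullet> u + 2 * (u \<bullet> v) + v \<bullet> v) / 4"
      by (simp add: w_def inner_add inner_commute field_simps)
    ultimately have "(norm (u - v))\<^sup>2 = 4 * F u + 4 * F v - 8 * F w"
      by (simp add: F_def power2_norm_eq_inner inner_diff inner_commute field_simps)
    then show ?thesis using m[OF w] by simp
  qed
  have "Cauchy s"
  proof (rule metric_CauchyI)
    fix e :: real assume e: "e > 0"
    \<comment> \<open>Each of the two terms in \<open>par\<close> should stay below
      \<open>e\<^sup>2 / 2\<close>. As \<open>F (s n) - m\<close> is less than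
      \<open>1 / (n + 1)\<close>, it suffices that \<open>8 / (n + 1) < e\<^sup>2\<close>.\<close>
    obtain N :: nat where "8 / e\<^sup>2 < real N" using reals_Archimedean2 by blast
    then have N: "8 < e\<^sup>2 * real N" using e by (simp add: field_simps)
    have bd: "4 * (F (s n) - m) < e\<^sup>2 / 2" if "n \<ge> N" for n
    proof -
      have "8 < e\<^sup>2 * real (Suc n)"
        using N that e by (smt (verit) mult_left_mono of_nat_le_iff of_nat_Suc zero_less_power)
      then have "8 / real (Suc n) < e\<^sup>2" by (simp only: divide_less_eq) simp
      then show ?thesis using sF[of n] by simp
    qed
    have "dist (s a) (s b) < e" if "a \<ge> N" "b \<ge> N" for a b
    proof -
      have "(norm (s a - s b))\<^sup>2 < e\<^sup>2"
        using par[OF s[of a] s[of b]] bd[OF that(1)] bd[OF that(2)] by linarith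
      then show ?thesis using e by (simp add: dist_norm power2_less_imp_less)
    qed
    then show "\<exists>N. \<forall>a\<ge>N. \<forall>b\<ge>N. dist (s a) (s b) < e" by blast
  qed
  then obtain z where z: "z \<in> S" and lim: "s \<longlonglongrightarrow> z"
    using comp s unfolding complete_def by blast
  have Fz: "F z \<le> m"
  proof -
    have d: "(\<lambda>n. norm (s n - z) * K) \<longlonglongrightarrow> 0"
      using lim by (auto intro!: tendsto_eq_intros)
    have "\<phi> (s n) - \<phi> z = \<phi> (s n - z)" for n
      using bounded_linear_on_diff[OF \<phi> sub s z] by simp
    then have "norm (\<phi> (s n) - \<phi> z) \<le> norm (s n - z) * K" for n
      using K[OF subspace_diff[OF sub s z]] by simp
    then have "(\<lambda>n. \<phi> (s n) - \<phi> z) \<longlonglongrightarrow> 0"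
      by (intro Lim_null_comparison[OF _ d]) auto
    then have "(\<lambda>n. \<phi> (s n)) \<longlonglongrightarrow> \<phi> z"
      by (simp add: LIM_zero_iff)
    then have 1: "(\<lambda>n. F (s n)) \<longlonglongrightarrow> F z"
      unfolding F_def by (intro tendsto_intros lim) auto
    have 2: "(\<lambda>n. m + 1 / real (Suc n)) \<longlonglongrightarrow> m"
      using tendsto_add[OF tendsto_const LIMSEQ_inverse_real_of_nat, of m] by (simp add: inverse_eq_divide)
    show ?thesis
      by (rule LIMSEQ_le[OF 1 2]) (use sF in \<open>auto intro!: less_imp_le\<close>)
  qed
  show ?thesis
  proof (rule that[OF z])
    fix u assume u: "u \<in> S"
    define a where "a = u \<bullet> z - \<phi> u"
    \<comment> \<open>First variation: \<open>z\<close> minimises \<open>F\<close> along every line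
      \<open>z + t *\<^sub>R u\<close>, and \<open>a\<close> is the derivative at
      \<open>t = 0\<close>.\<close>
    have quad: "t * a + t\<^sup>2 * (u \<bullet> u) / 2 \<ge> 0" for t
    proof -
      have tu: "t *\<^sub>R u \<in> S" by (rule subspace_scale[OF sub u])
      have "\<phi> (z + t *\<^sub>R u) = \<phi> z + t * \<phi> u"
        using bounded_linear_onD[OF \<phi>] z u tu by simp
      then have "F (z + t *\<^sub>R u) - F z = t * a + t\<^sup>2 * (u \<bullet> u) / 2"
        by (simp add: F_def a_def inner_add power2_eq_square inner_commute field_simps)
      moreover have "F z \<le> F (z + t *\<^sub>R u)"
        using Fz m[OF subspace_add[OF sub z tu]] by simp
      ultimately show ?thesis by simp
    qed
    have "a = 0"
    proof (rule ccontr)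
      assume a: "a \<noteq> 0"
      \<comment> \<open>Nearly the minimiser \<open>- a / (u \<bullet> u)\<close> of the quadratic;
        the added 1 keeps the denominator positive even for \<open>u = 0\<close>. With this
        \<open>t\<close> the linear term is \<open>- t\<^sup>2 * (u \<bullet> u + 1)\<close>, which
        outweighs the quadratic one.\<close>
      define t where "t = - a / (u \<bullet> u + 1)"
      have p: "u \<bullet> u + 1 > 0" using inner_ge_zero[of u] by linarith
      have "t * (u \<bullet> u + 1) = - a" using p by (simp add: t_def)
      then have "t\<^sup>2 * (u \<bullet> u + 1) = - (t * a)" by (simp add: power2_eq_square mult.assoc)
      moreover have "t\<^sup>2 * (u \<bullet> u) / 2 < t\<^sup>2 * (u \<bullet> u + 1)"
      proof -
        have "t\<^sup>2 > 0" using a p by (simp add: t_def)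
        moreover have "(u \<bullet> u) / 2 < u \<bullet> u + 1" using inner_ge_zero[of u] by linarith
        ultimately show ?thesis using mult_strict_left_mono by fastforce
      qed
      ultimately show False using quad[of t] by simp
    qed
    then show "\<phi> u = u \<bullet> z" by (simp add: a_def)
  qed
qed

text \<open>Existence is Riesz applied to \<open>f u \<bullet> w\<close> as a functional of
  \<open>u\<close>, bounded by Cauchy-Schwarz. Uniqueness holds because the difference of two
  candidates lies in \<open>S\<close> and is orthogonal to itself. Together they give meaning to the
  definite description.\<close>

lemma adjoint_on:
  fixes f :: "'a::real_inner \<Rightarrow> 'b::real_inner"
  assumes S: "hilbert_subspace S" and f: "bounded_linear_on S f"
  shows adjoint_on_mem: "adjoint_on S f w \<in> S"
    and inner_adjoint_on: "\<And>u. u \<in> S \<Longrightarrow> f u \<bullet> w = u \<bullet> adjoint_on S f w"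
proof -
  have sub: "subspace S" using S by (simp add: hilbert_subspace_def)
  obtain K where K: "\<And>u. u \<in> S \<Longrightarrow> norm (f u) \<le> norm u * K"
    using bounded_linear_on_pos_bound[OF f] by blast
  have "\<bar>f u \<bullet> w\<bar> \<le> norm u * (K * norm w)" if "u \<in> S" for u
    using Cauchy_Schwarz_ineq2[of "f u" w] mult_right_mono[OF K[OF that], of "norm w"] by (simp add: ac_simps)
  then have "bounded_linear_on S (\<lambda>u. f u \<bullet> w)"
    using f unfolding bounded_linear_on_def by (auto simp: inner_add_left)
  then obtain z where z: "z \<in> S" "\<And>u. u \<in> S \<Longrightarrow> f u \<bullet> w = u \<bullet> z"
    using riesz_representation_on[OF S] by blast
  have "\<exists>!z. z \<in> S \<and> (\<forall>u\<in>S. f u \<bullet> w = u \<bullet> z)"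
  proof (rule ex1I)
    show "z \<in> S \<and> (\<forall>u\<in>S. f u \<bullet> w = u \<bullet> z)" using z by blast
  next
    fix z' assume z': "z' \<in> S \<and> (\<forall>u\<in>S. f u \<bullet> w = u \<bullet> z')"
    have "z' - z \<in> S" using z z' subspace_diff[OF sub] by blast
    then have "(z' - z) \<bullet> z' = (z' - z) \<bullet> z" using z z' by metis
    then have "(z' - z) \<bullet> (z' - z) = 0" by (simp add: inner_diff_right)
    then show "z' = z" by simp
  qed
  from theI'[OF this]
  show "adjoint_on S f w \<in> S" "\<And>u. u \<in> S \<Longrightarrow> f u \<bullet> w = u \<bullet> adjoint_on S f w"
    unfolding adjoint_on_def by auto
qed

section \<open>Operator norms on subspaces and boundedness of the block operator\<close>

lemma ratio_le_onorm_on: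
  assumes f: "bounded_linear_on S f" and u: "u \<in> S"
  shows "norm (f u) / norm u \<le> onorm_on S f"
proof -
  obtain K where K: "K > 0" "\<And>u. u \<in> S \<Longrightarrow> norm (f u) \<le> norm u * K"
    using bounded_linear_on_pos_bound[OF f] by blast
  \<comment> \<open>A real supremum bounds its members only if the set is bounded above. Where
    \<open>norm u = 0\<close> the quotient is 0, hence the need for \<open>K > 0\<close>.\<close>
  have "norm (f u) / norm u \<le> K" if "u \<in> S" for u
    using K(1) K(2)[OF that] by (cases "norm u = 0") (simp_all add: divide_le_eq ac_simps)
  then have "bdd_above ((\<lambda>u. norm (f u) / norm u) ` S)"
    by (auto intro!: bdd_aboveI)
  then show ?thesis
    unfolding onorm_on_def by (rule cSUP_upper[OF u])
qed

lemma onorm_on_nonneg: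
  assumes "bounded_linear_on S f" "u \<in> S"
  shows "0 \<le> onorm_on S f"
  using ratio_le_onorm_on[OF assms] by (meson divide_nonneg_nonneg norm_ge_zero order_trans)

lemma norm_le_onorm_on:
  assumes f: "bounded_linear_on S f" and u: "u \<in> S"
  shows "norm (f u) \<le> onorm_on S f * norm u"
proof (cases "norm u = 0")
  \<comment> \<open>Here the quotient in \<open>onorm_on\<close> is 0 by convention and says nothing
    about \<open>f u\<close>, so the linear bound is used directly.\<close>
  case True
  then show ?thesis
    using bounded_linear_on_pos_bound[OF f] u by (metis mult_zero_left mult_zero_right)
next
  case False
  then show ?thesis
    using ratio_le_onorm_on[OF f u] by (simp add: divide_le_eq)
qed

lemma subspace_block_space:
  assumes "\<And>i. subspace (X i)"
  shows "subspace (block_space X)"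
  using assms by (auto simp: subspace_def block_space_def)

lemma bounded_linear_on_block_op:
  fixes X :: "'n::finite \<Rightarrow> 'x::real_normed_vector set"
  assumes A: "\<And>i. bounded_linear_on (X i) (A i)"
  shows "bounded_linear_on (block_space X) (block_op A)"
proof -
  have "\<exists>K>0. \<forall>u\<in>X i. norm (A i u) \<le> norm u * K" for i
    using bounded_linear_on_pos_bound[OF A, of i] by metis
  then obtain K where K: "\<And>i. K i > 0" "\<And>i u. u \<in> X i \<Longrightarrow> norm (A i u) \<le> norm u * K i"
    by metis
  have "norm (block_op A u) \<le> norm u * (\<Sum>i\<in>UNIV. K i)" if "u \<in> block_space X" for u
  proof -
    have "norm (A i (u $ i)) \<le> norm u * K i" for i
    proof -
      have "norm (A i (u $ i)) \<le> norm (u $ i) * K i"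
        using K(2) that by (simp add: block_space_def)
      also have "\<dots> \<le> norm u * K i"
        using K(1)[of i] by (intro mult_right_mono Finite_Cartesian_Product.norm_nth_le) simp
      finally show ?thesis .
    qed
    then show ?thesis
      unfolding block_op_def sum_distrib_left by (intro sum_norm_le) auto
  qed
  then show ?thesis
    using A unfolding bounded_linear_on_def
    by (auto simp: block_space_def block_op_def sum.distrib scaleR_sum_right)
qed

subsection \<open>One step of the iteration\<close>

text \<open>The Hilbert space adjoint of \<open>block_op A\<close> (see
  \<open>inner_block_adjoint\<close>), assembled from components because each update uses only one
  of them.\<close>

definition block_adjoint ::
  "('n::finite \<Rightarrow> 'x::real_inner set) \<Rightarrow> ('n \<Rightarrow> 'x \<Rightarrow> 'y::real_inner) \<Rightarrow> 'y \<Rightarrow> 'x ^ 'n" where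
  "block_adjoint X A r = (\<chi> i. adjoint_on (X i) (A i) r)"

lemma norm_axis: "norm (axis i u :: 'a::real_inner ^ 'n::finite) = norm u"
  by (simp add: norm_eq_sqrt_inner inner_axis_axis)

lemma norm_diff_scaleR_power2:
  fixes p q :: "'a::real_inner"
  shows "(norm (p - t *\<^sub>R q))\<^sup>2 = (norm p)\<^sup>2 - 2 * t * (q \<bullet> p) + t\<^sup>2 * (norm q)\<^sup>2"
  unfolding power2_norm_eq_inner by (simp add: inner_diff inner_commute power2_eq_square)

lemma norm_vec_power2: "(norm (u :: 'a::real_inner ^ 'n::finite))\<^sup>2 = (\<Sum>i\<in>UNIV. (norm (u $ i))\<^sup>2)"
  by (simp add: power2_norm_eq_inner inner_vec_def)

section \<open>The block operator, its norm and its adjoint\<close>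

locale block_system =
  fixes X :: "'n::finite \<Rightarrow> 'x::real_inner set"
    and A :: "'n \<Rightarrow> 'x \<Rightarrow> 'y::real_inner"
  assumes hilbert: "\<And>i. hilbert_subspace (X i)"
    and bounded: "\<And>i. bounded_linear_on (X i) (A i)"
begin

definition opnorm :: real where
  "opnorm = onorm_on (block_space X) (block_op A)"

lemma subspace_blocks: "subspace (block_space X)"
  using hilbert by (intro subspace_block_space) (simp add: hilbert_subspace_def)

lemma bounded_block_op: "bounded_linear_on (block_space X) (block_op A)"
  by (rule bounded_linear_on_block_op[OF bounded])

lemma norm_block_op_le: "u \<in> block_space X \<Longrightarrow> norm (block_op A u) \<le> opnorm * norm u"
  unfolding opnorm_def by (rule norm_le_onorm_on[OF bounded_block_op])

lemma block_op_diff: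
  "u \<in> block_space X \<Longrightarrow> v \<in> block_space X \<Longrightarrow> block_op A (u - v) = block_op A u - block_op A v"
  by (rule bounded_linear_on_diff[OF bounded_block_op subspace_blocks])

lemma block_adjoint_mem: "block_adjoint X A r \<in> block_space X"
  using adjoint_on_mem[OF hilbert bounded] by (simp add: block_adjoint_def block_space_def)

lemma inner_block_adjoint:
  "u \<in> block_space X \<Longrightarrow> block_op A u \<bullet> r = u \<bullet> block_adjoint X A r"
  using inner_adjoint_on[OF hilbert bounded]
  by (simp add: block_adjoint_def block_space_def block_op_def inner_vec_def inner_sum_left)

lemma axis_mem_block_space: "u \<in> X j \<Longrightarrow> axis j u \<in> block_space X"
  using hilbert by (auto simp: axis_def block_space_def hilbert_subspace_def subspace_0)

lemma axis_adjoint_mem: "axis j (block_adjoint X A r $ j) \<in> block_space X"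
  using block_adjoint_mem by (intro axis_mem_block_space) (simp add: block_space_def)

lemma opnorm_nonneg: "opnorm \<ge> 0"
  unfolding opnorm_def by (rule onorm_on_nonneg[OF bounded_block_op block_adjoint_mem])

text \<open>With \<open>z\<close> the adjoint at \<open>r\<close>, \<open>norm z * norm z\<close>
  equals \<open>block_op A z \<bullet> r\<close>, which is at most
  \<open>opnorm * norm z * norm r\<close>; one factor \<open>norm z\<close> cancels.\<close>

lemma norm_block_adjoint_le: "norm (block_adjoint X A r) \<le> opnorm * norm r"
proof (cases "block_adjoint X A r = 0")
  case True
  then show ?thesis using opnorm_nonneg by simp
next
  case False
  let ?z = "block_adjoint X A r"
  have "norm ?z * norm ?z = block_op A ?z \<bullet> r"
    using inner_block_adjoint[OF block_adjoint_mem] by (simp flip: power2_norm_eq_inner power2_eq_square)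
  also have "\<dots> \<le> norm (block_op A ?z) * norm r"
    by (rule norm_cauchy_schwarz)
  also have "\<dots> \<le> (opnorm * norm ?z) * norm r"
    by (intro mult_right_mono norm_block_op_le block_adjoint_mem) simp
  finally have "norm ?z * norm ?z \<le> (opnorm * norm r) * norm ?z"
    by (simp add: ac_simps)
  then show ?thesis
    using False by simp
qed

end

section \<open>Deterministic estimates for residual, error and gradient\<close>

locale rbcd_setting = block_system X A
  for X :: "'n::finite \<Rightarrow> 'x::real_inner set"
    and A :: "'n \<Rightarrow> 'x \<Rightarrow> 'y::real_inner" +
  fixes y y\<^sub>\<delta> :: 'y and \<delta> \<tau> \<mu> \<gamma> :: real
  assumes noise: "norm (y\<^sub>\<delta> - y) \<le> \<delta>"
    and \<delta>: "\<delta> > 0" and \<tau>: "\<tau> > 1" and \<gamma>: "\<gamma> > 0"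
    and \<gamma>_opnorm: "\<gamma> * opnorm\<^sup>2 = \<mu>"
begin

abbreviation step where
  "step \<equiv> rbcd_step X A y\<^sub>\<delta> \<gamma> \<tau> \<delta>"

definition res where
  "res u = block_op A u - y\<^sub>\<delta>"

definition stepsize where
  "stepsize u = discrepancy_step \<gamma> \<tau> \<delta> (res u)"

text \<open>The gradient of half the squared residual norm on the block space; its component
  \<open>j\<close> is the update direction of block \<open>j\<close>.\<close>

definition grad where
  "grad u = block_adjoint X A (res u)"

lemma stepsize_cases: "stepsize u = 0 \<or> stepsize u = \<gamma> \<and> norm (res u) > \<tau> * \<delta>"
  by (simp add: stepsize_def discrepancy_step_def)

lemma stepsize_nonneg: "stepsize u \<ge> 0"
  using stepsize_cases[of u] \<gamma> by auto

text \<open>Only the values 0 and \<gamma> occur. Lowering the power this way lets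
  \<open>\<gamma> * opnorm\<^sup>2 = \<mu>\<close> absorb the quadratic terms below.\<close>

lemma stepsize_power2: "(stepsize u)\<^sup>2 = \<gamma> * stepsize u"
  using stepsize_cases[of u] by (auto simp: power2_eq_square)

lemma step_eq: "step j u = u - stepsize u *\<^sub>R axis j (grad u $ j)"
  by (simp add: rbcd_step_def Let_def stepsize_def res_def grad_def block_adjoint_def axis_def vec_eq_iff)

lemma axis_grad_mem: "axis j (grad u $ j) \<in> block_space X"
  unfolding grad_def by (rule axis_adjoint_mem)

lemma step_mem: "u \<in> block_space X \<Longrightarrow> step j u \<in> block_space X"
  unfolding step_eq
  by (intro subspace_diff[OF subspace_blocks] subspace_scale[OF subspace_blocks] axis_grad_mem)

lemma norm_grad_le: "\<gamma> * (norm (grad u))\<^sup>2 \<le> \<mu> * (norm (res u))\<^sup>2"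
proof -
  have "(norm (grad u))\<^sup>2 \<le> (opnorm * norm (res u))\<^sup>2"
    unfolding grad_def by (intro power_mono norm_block_adjoint_le) simp
  then have "\<gamma> * (norm (grad u))\<^sup>2 \<le> \<gamma> * (opnorm * norm (res u))\<^sup>2"
    using \<gamma> by simp
  then show ?thesis
    by (simp add: power_mult_distrib flip: \<gamma>_opnorm mult.assoc)
qed

text \<open>In the expanded square, adjointness turns the cross term into minus twice the step size
  times \<open>(norm (grad u $ j))\<^sup>2\<close>, while the quadratic term costs at most \<mu>
  times the same product. For \<open>\<mu> < 2\<close> the residual thus cannot grow, whichever
  block is chosen.\<close>

lemma res_step:
  assumes u: "u \<in> block_space X"
  shows "(norm (res (step j u)))\<^sup>2 \<le> (norm (res u))\<^sup>2 - (2 - \<mu>) * stepsize u * (norm (grad u $ j))\<^sup>2"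
proof -
  let ?a = "axis j (grad u $ j)"
  let ?s = "stepsize u"
  have "block_op A (step j u) = block_op A u - ?s *\<^sub>R block_op A ?a"
    unfolding step_eq using block_op_diff[OF u] subspace_scale[OF subspace_blocks axis_grad_mem]
      bounded_linear_onD(2)[OF bounded_block_op axis_grad_mem] by simp
  then have "res (step j u) = res u - ?s *\<^sub>R block_op A ?a"
    by (simp add: res_def)
  then have "(norm (res (step j u)))\<^sup>2
      = (norm (res u))\<^sup>2 - 2 * ?s * (block_op A ?a \<bullet> res u) + ?s\<^sup>2 * (norm (block_op A ?a))\<^sup>2"
    by (simp add: norm_diff_scaleR_power2)
  moreover have "block_op A ?a \<bullet> res u = (norm (grad u $ j))\<^sup>2"
    using inner_block_adjoint[OF axis_grad_mem, of j u "res u"]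
    by (simp add: inner_axis' power2_norm_eq_inner flip: grad_def)
  moreover have "?s\<^sup>2 * (norm (block_op A ?a))\<^sup>2 \<le> ?s * \<mu> * (norm (grad u $ j))\<^sup>2"
  proof -
    have "(norm (block_op A ?a))\<^sup>2 \<le> (opnorm * norm (grad u $ j))\<^sup>2"
      using norm_block_op_le[OF axis_grad_mem, of j u] by (intro power_mono) (simp_all add: norm_axis)
    then have "?s\<^sup>2 * (norm (block_op A ?a))\<^sup>2 \<le> ?s\<^sup>2 * (opnorm * norm (grad u $ j))\<^sup>2"
      by (intro mult_left_mono) auto
    also have "\<dots> = ?s * \<mu> * (norm (grad u $ j))\<^sup>2"
      by (simp add: stepsize_power2 power_mult_distrib flip: \<gamma>_opnorm)
    finally show ?thesis .
  qed
  ultimately show ?thesis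
    by (simp add: algebra_simps)
qed

lemma error_step:
  "(norm (step j u - v))\<^sup>2 =
    (norm (u - v))\<^sup>2 - 2 * stepsize u * (grad u $ j \<bullet> (u - v) $ j) + (stepsize u)\<^sup>2 * (norm (grad u $ j))\<^sup>2"
proof -
  have "step j u - v = (u - v) - stepsize u *\<^sub>R axis j (grad u $ j)"
    by (simp add: step_eq)
  then show ?thesis
    by (simp only: norm_diff_scaleR_power2 inner_axis' norm_axis)
qed

text \<open>As \<open>v\<close> solves the exact equation, \<open>block_op A (u - v)\<close> is the
  residual plus the noise \<open>y\<^sub>\<delta> - y\<close>. Adjointness gives the squared
  residual up to a noise term controlled by Cauchy-Schwarz.\<close>

lemma inner_grad_ge:
  assumes u: "u \<in> block_space X" and v: "v \<in> block_space X" "block_op A v = y"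
  shows "grad u \<bullet> (u - v) \<ge> (norm (res u))\<^sup>2 - \<delta> * norm (res u)"
proof -
  have uv: "u - v \<in> block_space X" by (rule subspace_diff[OF subspace_blocks u v(1)])
  have "block_op A (u - v) = res u + (y\<^sub>\<delta> - y)"
    by (simp add: block_op_diff[OF u v(1)] v(2) res_def)
  then have "grad u \<bullet> (u - v) = (norm (res u))\<^sup>2 + (y\<^sub>\<delta> - y) \<bullet> res u"
    using inner_block_adjoint[OF uv, of "res u"]
    by (simp add: grad_def inner_commute inner_add power2_norm_eq_inner)
  moreover have "\<bar>(y\<^sub>\<delta> - y) \<bullet> res u\<bar> \<le> \<delta> * norm (res u)"
    using Cauchy_Schwarz_ineq2[of "y\<^sub>\<delta> - y" "res u"] mult_right_mono[OF noise, of "norm (res u)"] by simp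
  ultimately show ?thesis by linarith
qed

text \<open>The sum over \<open>j\<close> is \<open>b\<close> times the average over a uniform
  index. The blockwise inner products and squared norms add up to those of the full
  gradient.\<close>

lemma sum_error_step:
  assumes u: "u \<in> block_space X" and v: "v \<in> block_space X" "block_op A v = y"
  shows "(\<Sum>j\<in>UNIV. (norm (step j u - v))\<^sup>2)
    \<le> real CARD('n) * (norm (u - v))\<^sup>2 - (2 - 2 / \<tau> - \<mu>) * (stepsize u * (norm (res u))\<^sup>2)"
proof -
  let ?s = "stepsize u" and ?r = "norm (res u)"
  have "(\<Sum>j\<in>UNIV. (norm (step j u - v))\<^sup>2)
      = real CARD('n) * (norm (u - v))\<^sup>2 - 2 * ?s * (grad u \<bullet> (u - v)) + ?s\<^sup>2 * (norm (grad u))\<^sup>2"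
    unfolding error_step inner_vec_def[of "grad u"] norm_vec_power2[of "grad u"]
    by (simp add: sum.distrib sum_subtractf sum_distrib_left)
  also have "\<dots> \<le> real CARD('n) * (norm (u - v))\<^sup>2 - 2 * ?s * (?r\<^sup>2 - ?r\<^sup>2 / \<tau>) + ?s * (\<mu> * ?r\<^sup>2)"
  proof -
    \<comment> \<open>Without a step both sides vanish. Otherwise the discrepancy principle gives
      \<open>\<delta> \<le> ?r / \<tau>\<close>, which turns the noise term into
      \<open>?r\<^sup>2 / \<tau>\<close>.\<close>
    have "?s * (?r\<^sup>2 - ?r\<^sup>2 / \<tau>) \<le> ?s * (grad u \<bullet> (u - v))"
    proof (cases "?s = 0")
      case False
      then have "?r > \<tau> * \<delta>" using stepsize_cases[of u] by blast
      then have "\<delta> \<le> ?r / \<tau>" using \<tau> by (simp add: field_simps)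
      then have "\<delta> * ?r \<le> ?r / \<tau> * ?r" by (intro mult_right_mono) auto
      then show ?thesis
        using inner_grad_ge[OF u v] stepsize_nonneg[of u]
        by (intro mult_left_mono) (auto simp: power2_eq_square)
    qed simp
    moreover have "?s\<^sup>2 * (norm (grad u))\<^sup>2 \<le> ?s * (\<mu> * ?r\<^sup>2)"
      using mult_left_mono[OF norm_grad_le stepsize_nonneg, of u u] by (simp add: stepsize_power2 ac_simps)
    ultimately show ?thesis by simp
  qed
  also have "\<dots> = real CARD('n) * (norm (u - v))\<^sup>2 - (2 - 2 / \<tau> - \<mu>) * (?s * ?r\<^sup>2)"
    using \<tau> by (simp add: field_simps)
  finally show ?thesis .
qed

lemma sum_res_step:
  assumes u: "u \<in> block_space X"
  shows "(\<Sum>j\<in>UNIV. (norm (res (step j u)))\<^sup>2)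
    \<le> real CARD('n) * (norm (res u))\<^sup>2 - (2 - \<mu>) * (stepsize u * (norm (grad u))\<^sup>2)"
proof -
  have "(\<Sum>j\<in>UNIV. (norm (res (step j u)))\<^sup>2)
      \<le> (\<Sum>j\<in>UNIV. (norm (res u))\<^sup>2 - (2 - \<mu>) * stepsize u * (norm (grad u $ j))\<^sup>2)"
    by (intro sum_mono res_step u)
  also have "\<dots> = real CARD('n) * (norm (res u))\<^sup>2 - (2 - \<mu>) * (stepsize u * (norm (grad u))\<^sup>2)"
    by (simp add: norm_vec_power2[of "grad u"] sum_subtractf sum_distrib_left ac_simps)
  finally show ?thesis .
qed

text \<open>Before termination the gradient can be small only where the error is large. The constant
  is the value of \<open>r * (r - \<delta>)\<close> at the threshold
  \<open>r = \<tau> * \<delta>\<close>.\<close>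

lemma norm_grad_ge:
  assumes u: "u \<in> block_space X" and v: "v \<in> block_space X" "block_op A v = y"
    and r: "norm (res u) > \<tau> * \<delta>"
  shows "norm (grad u) * norm (u - v) \<ge> \<tau> * (\<tau> - 1) * \<delta>\<^sup>2"
proof -
  have "\<tau> * (\<tau> - 1) * \<delta>\<^sup>2 = (\<tau> * \<delta>) * (\<tau> * \<delta> - \<delta>)"
    by (simp add: power2_eq_square algebra_simps)
  also have "\<dots> \<le> norm (res u) * (norm (res u) - \<delta>)"
    using r \<tau> \<delta> by (intro mult_mono) (auto simp: algebra_simps)
  also have "\<dots> \<le> grad u \<bullet> (u - v)"
    using inner_grad_ge[OF u v] by (simp add: power2_eq_square algebra_simps)
  also have "\<dots> \<le> norm (grad u) * norm (u - v)"
    by (rule norm_cauchy_schwarz)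
  finally show ?thesis .
qed

lemma rbcd_mem: "x\<^sub>0 \<in> block_space X \<Longrightarrow> rbcd X A y\<^sub>\<delta> \<gamma> \<tau> \<delta> x\<^sub>0 j k \<in> block_space X"
  by (induction k) (simp_all add: step_mem)

text \<open>The increments are square summable along every path, so the error grows at most like \<open>\<surd>k\<close>
  even if \<open>\<mu>\<close> is too large for it to decrease on average.\<close>

lemma error_growth:
  fixes j :: "nat \<Rightarrow> 'n"
  assumes \<mu>: "\<mu> < 2" and x\<^sub>0: "x\<^sub>0 \<in> block_space X"
  defines "x \<equiv> rbcd X A y\<^sub>\<delta> \<gamma> \<tau> \<delta> x\<^sub>0 j"
  shows "(norm (x k - v))\<^sup>2
    \<le> real (Suc k) * ((norm (x\<^sub>0 - v))\<^sup>2 + \<gamma> / (2 - \<mu>) * ((norm (res x\<^sub>0))\<^sup>2 - (norm (res (x k)))\<^sup>2))"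
proof (induction k)
  case 0
  then show ?case by (simp add: x_def)
next
  case (Suc k)
  \<comment> \<open>The bracket of the claim as a function of \<open>k\<close>: initial squared
    error plus the scaled drop of the squared residual so far. Its increments dominate the squared
    lengths \<beta> of the updates.\<close>
  define B where "B k = (norm (x\<^sub>0 - v))\<^sup>2 + \<gamma> / (2 - \<mu>) * ((norm (res x\<^sub>0))\<^sup>2 - (norm (res (x k)))\<^sup>2)" for k
  let ?n = "real (Suc k)"
  define \<alpha> where "\<alpha> = norm (x k - v)"
  define \<beta> where "\<beta> = stepsize (x k) * norm (grad (x k) $ j k)"
  have x_Suc: "x (Suc k) = step (j k) (x k)" by (simp add: x_def)
  have \<alpha>: "\<alpha>\<^sup>2 \<le> ?n * B k" using Suc by (simp add: \<alpha>_def B_def)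
  have \<beta>: "\<beta>\<^sup>2 \<le> B (Suc k) - B k"
  proof -
    have "(2 - \<mu>) * (stepsize (x k) * (norm (grad (x k) $ j k))\<^sup>2)
        \<le> (norm (res (x k)))\<^sup>2 - (norm (res (x (Suc k))))\<^sup>2"
      using res_step[OF rbcd_mem[OF x\<^sub>0, of j k, folded x_def], of "j k"] by (simp add: x_Suc ac_simps)
    then have "stepsize (x k) * (norm (grad (x k) $ j k))\<^sup>2
        \<le> ((norm (res (x k)))\<^sup>2 - (norm (res (x (Suc k))))\<^sup>2) / (2 - \<mu>)"
      using \<mu> by (simp add: le_divide_eq ac_simps)
    from mult_left_mono[OF this, of \<gamma>] \<gamma> show ?thesis
      by (simp add: \<beta>_def power_mult_distrib stepsize_power2 B_def algebra_simps diff_divide_distrib)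
  qed
  have "norm (x (Suc k) - v) \<le> \<alpha> + \<beta>"
  proof -
    have "x (Suc k) - v = (x k - v) - stepsize (x k) *\<^sub>R axis (j k) (grad (x k) $ j k)"
      by (simp add: x_Suc step_eq)
    then have "norm (x (Suc k) - v) \<le> norm (x k - v) + norm (stepsize (x k) *\<^sub>R axis (j k) (grad (x k) $ j k))"
      by (simp only: norm_triangle_ineq4)
    then show ?thesis
      using stepsize_nonneg[of "x k"] by (simp add: \<alpha>_def \<beta>_def norm_axis)
  qed
  then have "(norm (x (Suc k) - v))\<^sup>2 \<le> (\<alpha> + \<beta>)\<^sup>2"
    by (rule power_mono) simp
  moreover have "?n * (\<alpha> + \<beta>)\<^sup>2 \<le> ?n * ((?n + 1) * B (Suc k))"
  proof -
    \<comment> \<open>Young's inequality \<open>(\<alpha> + \<beta>)\<^sup>2 \<le> (1 + 1/n) *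
      \<alpha>\<^sup>2 + (1 + n) * \<beta>\<^sup>2\<close>, multiplied by \<open>n\<close>, with the
      discarded square written out. The weight \<open>n = k + 1\<close> gives \<open>B k\<close> and
      the increment the same factor, so \<open>B k\<close> cancels.\<close>
    have "?n * (\<alpha> + \<beta>)\<^sup>2 + (\<alpha> - ?n * \<beta>)\<^sup>2 = (?n + 1) * \<alpha>\<^sup>2 + ?n * (?n + 1) * \<beta>\<^sup>2"
      by (simp only: power2_eq_square algebra_simps)
    also have "\<dots> \<le> (?n + 1) * (?n * B k) + ?n * (?n + 1) * (B (Suc k) - B k)"
      by (intro add_mono mult_left_mono \<alpha> \<beta>) auto
    also have "\<dots> = ?n * ((?n + 1) * B (Suc k))"
      by (simp only: algebra_simps)
    finally show ?thesis
      using zero_le_power2[of "\<alpha> - ?n * \<beta>"] by linarith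
  qed
  then have "(\<alpha> + \<beta>)\<^sup>2 \<le> (?n + 1) * B (Suc k)"
    by (simp only: mult_le_cancel_left_pos of_nat_0_less_iff zero_less_Suc)
  ultimately show ?case
    by (simp add: B_def)
qed

end

text \<open>Iterate \<open>k\<close> sees only the indices before \<open>k\<close>; this is what
  makes it independent of the index drawn at step \<open>k\<close>.\<close>

lemma rbcd_cong:
  assumes "\<And>l. l < k \<Longrightarrow> j l = j' l"
  shows "rbcd X A y\<^sub>\<delta> \<gamma> \<tau> \<delta> x\<^sub>0 j k = rbcd X A y\<^sub>\<delta> \<gamma> \<tau> \<delta> x\<^sub>0 j' k"
  using assms by (induction k) simp_all

subsection \<open>Random indices\<close>

locale uniform_indices = prob_space M for M :: "'w measure" +
  fixes idx :: "nat \<Rightarrow> 'w \<Rightarrow> 'n::finite"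
  assumes indep: "indep_vars (\<lambda>_. count_space UNIV) idx UNIV"
    and uniform: "distr M (count_space UNIV) (idx k) = uniform_count_measure UNIV"
begin

text \<open>The restriction confines the values to the finite set
  \<open>{..<k} \<rightarrow>\<^sub>E UNIV\<close>.\<close>

definition history :: "nat \<Rightarrow> 'w \<Rightarrow> nat \<Rightarrow> 'n" where
  "history k \<omega> = restrict (\<lambda>l. idx l \<omega>) {..<k}"

lemma measurable_idx [measurable]: "idx k \<in> measurable M (count_space UNIV)"
  using indep by (simp add: indep_vars_def)

text \<open>A finite product of finite discrete spaces is discrete. Real functions of the iterates
  are therefore measurable without any sigma-algebra on the Hilbert spaces.\<close>

lemma measurable_PiM_indices:
  "finite I \<Longrightarrow> (f :: (nat \<Rightarrow> 'n) \<Rightarrow> real) \<in> borel_measurable (PiM I (\<lambda>_. count_space UNIV))"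
  by (simp add: count_space_PiM_finite)

lemma measurable_history: "(\<lambda>\<omega>. f (history k \<omega>) :: real) \<in> borel_measurable M"
proof -
  have "history k \<in> measurable M (PiM {..<k} (\<lambda>_. count_space UNIV))"
    unfolding history_def by (rule measurable_restrict) simp
  from measurable_compose[OF this measurable_PiM_indices] show ?thesis by simp
qed

lemma integrable_history: "integrable M (\<lambda>\<omega>. f (history k \<omega>) :: real)"
proof (rule integrable_const_bound)
  let ?P = "{..<k} \<rightarrow>\<^sub>E (UNIV :: 'n set)"
  have "finite ((\<lambda>h. \<bar>f h\<bar>) ` ?P)" by (intro finite_imageI finite_PiE) auto
  moreover have "history k \<omega> \<in> ?P" for \<omega> by (simp add: history_def)
  ultimately show "AE \<omega> in M. norm (f (history k \<omega>)) \<le> Max ((\<lambda>h. \<bar>f h\<bar>) ` ?P)"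
    by (intro always_eventually allI) auto
qed (rule measurable_history)

text \<open>Takes the place of conditioning on the past: split by the value \<open>i\<close> of the
  next index, whose indicator is independent of the history and has mean
  \<open>1 / b\<close>.\<close>

lemma expectation_next_index:
  "expectation (\<lambda>\<omega>. F (idx k \<omega>) (history k \<omega>) :: real)
    = expectation (\<lambda>\<omega>. \<Sum>i\<in>UNIV. F i (history k \<omega>)) / real CARD('n)"
proof -
  let ?I = "\<lambda>i \<omega>. indicator {i} (idx k \<omega>) :: real"
  have I: "integrable M (?I i)" for i
    by (rule integrable_const_bound[where B = 1]) (auto simp: indicator_def)
  have EI: "expectation (?I i) = 1 / real CARD('n)" for i
  proof -
    have "expectation (?I i) = (\<integral>j. indicator {i} j \<partial>distr M (count_space UNIV) (idx k))"
      by (rule integral_distr[symmetric]) auto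
    also have "\<dots> = measure (uniform_count_measure (UNIV :: 'n set)) {i}"
      by (simp add: uniform space_uniform_count_measure)
    finally show ?thesis
      by (simp add: measure_uniform_count_measure)
  qed
  have iv: "indep_var borel (?I i) borel (\<lambda>\<omega>. F i (history k \<omega>))" for i
  proof -
    have "indep_var (PiM {k} (\<lambda>_. count_space UNIV)) (\<lambda>\<omega>. restrict (\<lambda>l. idx l \<omega>) {k})
        (PiM {..<k} (\<lambda>_. count_space UNIV)) (history k)"
      unfolding history_def by (rule indep_var_restrict[OF indep]) auto
    from indep_var_compose[OF this measurable_PiM_indices measurable_PiM_indices,
        of "\<lambda>h. indicator {i} (h k)" "F i"]
    show ?thesis by (simp add: comp_def)
  qed
  have "expectation (\<lambda>\<omega>. F (idx k \<omega>) (history k \<omega>))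
      = expectation (\<lambda>\<omega>. \<Sum>i\<in>UNIV. ?I i \<omega> * F i (history k \<omega>))"
    by (intro Bochner_Integration.integral_cong refl) (simp add: indicator_def)
  also have "\<dots> = (\<Sum>i\<in>UNIV. expectation (\<lambda>\<omega>. ?I i \<omega> * F i (history k \<omega>)))"
    by (intro Bochner_Integration.integral_sum indep_var_integrable[OF iv I integrable_history])
  also have "\<dots> = (\<Sum>i\<in>UNIV. expectation (\<lambda>\<omega>. F i (history k \<omega>)) / real CARD('n))"
    by (simp add: indep_var_lebesgue_integral[OF iv I integrable_history] EI)
  also have "\<dots> = expectation (\<lambda>\<omega>. \<Sum>i\<in>UNIV. F i (history k \<omega>)) / real CARD('n)"
    by (subst Bochner_Integration.integral_sum) (auto intro: integrable_history simp: sum_divide_distrib)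
  finally show ?thesis .
qed

end

section \<open>The random iteration: descent in expectation and almost sure termination\<close>

locale random_rbcd = rbcd_setting X A y y\<^sub>\<delta> \<delta> \<tau> \<mu> \<gamma> + uniform_indices M idx
  for X :: "'n::finite \<Rightarrow> 'x::real_inner set"
    and A :: "'n \<Rightarrow> 'x \<Rightarrow> 'y::real_inner"
    and y y\<^sub>\<delta> \<delta> \<tau> \<mu> \<gamma>
    and M :: "'w measure" and idx :: "nat \<Rightarrow> 'w \<Rightarrow> 'n" +
  fixes x\<^sub>0 :: "'x ^ 'n"
  assumes x\<^sub>0: "x\<^sub>0 \<in> block_space X"
begin

definition iterate :: "nat \<Rightarrow> 'w \<Rightarrow> 'x ^ 'n" where
  "iterate k \<omega> = rbcd X A y\<^sub>\<delta> \<gamma> \<tau> \<delta> x\<^sub>0 (\<lambda>l. idx l \<omega>) k"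

lemma iterate_history: "iterate k \<omega> = rbcd X A y\<^sub>\<delta> \<gamma> \<tau> \<delta> x\<^sub>0 (history k \<omega>) k"
  unfolding iterate_def by (rule rbcd_cong) (simp add: history_def)

lemma iterate_mem: "iterate k \<omega> \<in> block_space X"
  unfolding iterate_def by (rule rbcd_mem[OF x\<^sub>0])

lemma integrable_iterate: "integrable M (\<lambda>\<omega>. f (iterate k \<omega>) :: real)"
  unfolding iterate_history by (rule integrable_history)

lemma expectation_iterate_Suc:
  "expectation (\<lambda>\<omega>. f (iterate (Suc k) \<omega>) :: real)
    = expectation (\<lambda>\<omega>. \<Sum>j\<in>UNIV. f (step j (iterate k \<omega>))) / real CARD('n)"
proof -
  have "iterate (Suc k) \<omega> = step (idx k \<omega>) (iterate k \<omega>)" for \<omega>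
    by (simp add: iterate_def)
  then show ?thesis
    unfolding iterate_history[of k]
    using expectation_next_index[of "\<lambda>j h. f (step j (rbcd X A y\<^sub>\<delta> \<gamma> \<tau> \<delta> x\<^sub>0 h k))" k] by simp
qed

text \<open>Lifts a pointwise estimate summed over the blocks to expectations. It serves both the
  squared error and the squared residual.\<close>

lemma expectation_decrease:
  assumes "\<And>u. u \<in> block_space X \<Longrightarrow> (\<Sum>j\<in>UNIV. f (step j u)) \<le> real CARD('n) * f u - c * g u"
  shows "expectation (\<lambda>\<omega>. f (iterate (Suc k) \<omega>))
    \<le> expectation (\<lambda>\<omega>. f (iterate k \<omega>)) - c / real CARD('n) * expectation (\<lambda>\<omega>. g (iterate k \<omega>))"
proof -
  have "expectation (\<lambda>\<omega>. \<Sum>j\<in>UNIV. f (step j (iterate k \<omega>)))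
      \<le> expectation (\<lambda>\<omega>. real CARD('n) * f (iterate k \<omega>) - c * g (iterate k \<omega>))"
    using assms[OF iterate_mem]
    by (intro integral_mono integrable_iterate[of "\<lambda>u. \<Sum>j\<in>UNIV. f (step j u)"]
        integrable_iterate[of "\<lambda>u. real CARD('n) * f u - c * g u"])
  also have "\<dots> = real CARD('n) * expectation (\<lambda>\<omega>. f (iterate k \<omega>)) - c * expectation (\<lambda>\<omega>. g (iterate k \<omega>))"
    using integrable_iterate[of f k] integrable_iterate[of g k] by simp
  finally show ?thesis
    unfolding expectation_iterate_Suc by (simp add: field_simps)
qed

lemma AE_terminates:
  assumes \<mu>: "\<mu> < 2" and v: "v \<in> block_space X" "block_op A v = y"
  shows "AE \<omega> in M. \<exists>k. norm (res (iterate k \<omega>)) \<le> \<tau> * \<delta>"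
proof -
  define N where "N = {\<omega>\<in>space M. \<forall>k. norm (res (iterate k \<omega>)) > \<tau> * \<delta>}"
  have [measurable]: "(\<lambda>\<omega>. norm (res (iterate k \<omega>))) \<in> borel_measurable M" for k
    using integrable_iterate[of "\<lambda>u. norm (res u)" k] by (rule borel_measurable_integrable)
  have N [measurable]: "N \<in> sets M" unfolding N_def by measurable
  \<comment> \<open>The factor from \<open>error_growth\<close> with the current residual dropped;
    the added 1 makes it positive, so that it can be divided by.\<close>
  define B where "B = (norm (x\<^sub>0 - v))\<^sup>2 + \<gamma> / (2 - \<mu>) * (norm (res x\<^sub>0))\<^sup>2 + 1"
  define \<eta> where "\<eta> = \<tau> * (\<tau> - 1) * \<delta>\<^sup>2"
  have \<eta>: "\<eta> > 0" using \<tau> \<delta> by (simp add: \<eta>_def)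
  have B: "B > 0" using \<gamma> \<mu> by (simp add: B_def add_nonneg_pos)
  define E where "E k = expectation (\<lambda>\<omega>. (norm (res (iterate k \<omega>)))\<^sup>2)" for k
  define G where "G k = expectation (\<lambda>\<omega>. stepsize (iterate k \<omega>) * (norm (grad (iterate k \<omega>)))\<^sup>2)" for k
  define c where "c = (2 - \<mu>) / real CARD('n)"
  have c: "c > 0" using \<mu> by (simp add: c_def)
  \<comment> \<open>Collects the factors for which \<open>c * G k\<close> is at least
    \<open>\<kappa> / (k + 1)\<close>. Apart from \<open>prob N\<close> all of them are
    positive.\<close>
  define \<kappa> where "\<kappa> = c * (prob N * (\<gamma> * (\<eta>\<^sup>2 / B)))"
  have dec: "E (Suc k) \<le> E k - c * G k" for k
    unfolding E_def G_def c_def by (rule expectation_decrease[OF sum_res_step])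
  have low: "\<gamma> * (\<eta>\<^sup>2 / B) / real (Suc k) \<le> stepsize (iterate k \<omega>) * (norm (grad (iterate k \<omega>)))\<^sup>2"
    if "\<omega> \<in> N" for k \<omega>
  proof -
    let ?u = "iterate k \<omega>"
    have r: "norm (res ?u) > \<tau> * \<delta>" using that by (simp add: N_def)
    have "(norm (?u - v))\<^sup>2 \<le> real (Suc k) * B"
    proof -
      have "\<gamma> / (2 - \<mu>) * ((norm (res x\<^sub>0))\<^sup>2 - (norm (res ?u))\<^sup>2) \<le> \<gamma> / (2 - \<mu>) * (norm (res x\<^sub>0))\<^sup>2"
        using \<gamma> \<mu> by (intro mult_left_mono) auto
      then have "real (Suc k) * ((norm (x\<^sub>0 - v))\<^sup>2 + \<gamma> / (2 - \<mu>) * ((norm (res x\<^sub>0))\<^sup>2 - (norm (res ?u))\<^sup>2))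
          \<le> real (Suc k) * B"
        unfolding B_def by (intro mult_left_mono) linarith+
      then show ?thesis
        using error_growth[OF \<mu> x\<^sub>0, of "\<lambda>l. idx l \<omega>" k v] by (simp only: iterate_def)
    qed
    have "\<eta>\<^sup>2 \<le> (norm (grad ?u) * norm (?u - v))\<^sup>2"
      using norm_grad_ge[OF iterate_mem v r] \<eta> by (intro power_mono) (auto simp: \<eta>_def)
    also have "\<dots> \<le> (norm (grad ?u))\<^sup>2 * (real (Suc k) * B)"
      unfolding power_mult_distrib by (intro mult_left_mono) (fact, simp)
    finally have "\<eta>\<^sup>2 / B / real (Suc k) \<le> (norm (grad ?u))\<^sup>2"
      using B by (simp add: divide_le_eq ac_simps)
    from mult_left_mono[OF this, of \<gamma>] show ?thesis
      using \<gamma> r by (simp add: stepsize_def discrepancy_step_def)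
  qed
  have G: "\<kappa> * inverse (real (Suc k)) \<le> c * G k" for k
  proof -
    \<comment> \<open>On \<open>N\<close> the integrand obeys \<open>low\<close>; off
      \<open>N\<close> it is still nonnegative, so the indicator gives a lower bound
      everywhere.\<close>
    have "expectation (\<lambda>\<omega>. indicator N \<omega> * (\<gamma> * (\<eta>\<^sup>2 / B) / real (Suc k))) \<le> G k"
      unfolding G_def
    proof (rule integral_mono)
      show "integrable M (\<lambda>\<omega>. indicator N \<omega> * (\<gamma> * (\<eta>\<^sup>2 / B) / real (Suc k)))"
        by (intro integrable_mult_left) (simp add: emeasure_eq_measure)
      show "integrable M (\<lambda>\<omega>. stepsize (iterate k \<omega>) * (norm (grad (iterate k \<omega>)))\<^sup>2)"
        by (rule integrable_iterate[of "\<lambda>u. stepsize u * (norm (grad u))\<^sup>2"])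
      show "indicator N \<omega> * (\<gamma> * (\<eta>\<^sup>2 / B) / real (Suc k))
          \<le> stepsize (iterate k \<omega>) * (norm (grad (iterate k \<omega>)))\<^sup>2" for \<omega>
        using low[of \<omega> k] stepsize_nonneg by (cases "\<omega> \<in> N") simp_all
    qed
    also have "expectation (\<lambda>\<omega>. indicator N \<omega> * (\<gamma> * (\<eta>\<^sup>2 / B) / real (Suc k)))
        = prob N * (\<gamma> * (\<eta>\<^sup>2 / B) / real (Suc k))"
      using N by simp
    finally show ?thesis
      using mult_left_mono[of _ "G k" c] c by (simp add: \<kappa>_def divide_inverse ac_simps)
  qed
  have \<kappa>_nonneg: "\<kappa> \<ge> 0" using c \<gamma> B by (simp add: \<kappa>_def)
  have "(\<Sum>k<n. \<kappa> * inverse (real (Suc k))) \<le> E 0" for n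
  proof -
    \<comment> \<open>The decrease \<open>dec\<close> telescopes, so the total of the lower bounds
      is at most the initial squared residual.\<close>
    have "(\<Sum>k<n. \<kappa> * inverse (real (Suc k))) \<le> E 0 - E n"
    proof (induction n)
      case (Suc n)
      then show ?case using G[of n] dec[of n] by simp
    qed simp
    moreover have "E n \<ge> 0" by (simp add: E_def)
    ultimately show ?thesis by simp
  qed
  then have "summable (\<lambda>k. \<kappa> * inverse (real (Suc k)))"
    using \<kappa>_nonneg by (intro summableI_nonneg_bounded) auto
  \<comment> \<open>A summable multiple of the harmonic series has factor 0; the index shift matches
    \<open>Suc k\<close> to the library form.\<close>
  then have "\<kappa> = 0"
    using not_summable_harmonic[where ?'a = real]
      summable_Suc_iff[of "\<lambda>k. inverse (real k)"] by (simp only: summable_cmult_iff) blast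
  then have "prob N = 0"
    using c \<gamma> B \<eta> by (simp add: \<kappa>_def)
  then have "N \<in> null_sets M"
    using N by (simp add: null_sets_def emeasure_eq_measure)
  then show ?thesis
    by (rule AE_I') (auto simp: N_def not_le)
qed

end

theorem proposition2p7:
  fixes X :: "'n::finite \<Rightarrow> 'x::real_inner set"
    and A :: "'n \<Rightarrow> 'x \<Rightarrow> 'y::{real_inner, complete_space}"
    and y y\<^sub>\<delta> :: 'y
    and \<delta> \<tau> \<mu> \<gamma> :: real
    and x\<^sub>0 :: "'x ^ 'n"
    and M :: "'w measure"
    and idx :: "nat \<Rightarrow> 'w \<Rightarrow> 'n"
    and x :: "nat \<Rightarrow> 'w \<Rightarrow> 'x ^ 'n"
  assumes "\<And>i. hilbert_subspace (X i)"
    and "\<And>i. bounded_linear_on (X i) (A i)"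
    and "y \<in> block_op A ` block_space X"
    and "\<delta> > 0"
    and "norm (y\<^sub>\<delta> - y) \<le> \<delta>"
    and "prob_space M"
    and "prob_space.indep_vars M (\<lambda>_. count_space UNIV) idx UNIV"
    and "\<And>k. distr M (count_space UNIV) (idx k) = uniform_count_measure UNIV"
    and "x\<^sub>0 \<in> block_space X"
    and "\<tau> > 1"
    and "\<gamma> > 0"
    and "0 < \<mu>" and "\<mu> < 2"
    and "\<gamma> = \<mu> / (onorm_on (block_space X) (block_op A))\<^sup>2"
    and x_def: "\<And>k \<omega>. x k \<omega> = rbcd X A y\<^sub>\<delta> \<gamma> \<tau> \<delta> x\<^sub>0 (\<lambda>l. idx l \<omega>) k"
  shows "(AE \<omega> in M. \<exists>k. norm (block_op A (x k \<omega>) - y\<^sub>\<delta>) \<le> \<tau> * \<delta>) \<and>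
    (\<mu> < 2 - 2 / \<tau> \<longrightarrow>
      (let c\<^sub>1 = (2 - 2 / \<tau> - \<mu>) / real CARD('n) in
        c\<^sub>1 > 0 \<and>
        (\<forall>xbar \<in> block_space X. block_op A xbar = y \<longrightarrow>
          (\<forall>k. (\<integral>\<omega>. (norm (x (Suc k) \<omega> - xbar))\<^sup>2 \<partial>M)
             \<le> (\<integral>\<omega>. (norm (x k \<omega> - xbar))\<^sup>2 \<partial>M)
               - c\<^sub>1 * (\<integral>\<omega>. discrepancy_step \<gamma> \<tau> \<delta> (block_op A (x k \<omega>) - y\<^sub>\<delta>)
                              * (norm (block_op A (x k \<omega>) - y\<^sub>\<delta>))\<^sup>2 \<partial>M)))))"
proof -
  interpret block_system X A
    using assms(1,2) by unfold_locales
  have \<gamma>: "\<gamma> = \<mu> / opnorm\<^sup>2"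
    using assms(14) by (simp add: opnorm_def)
  \<comment> \<open>If \<open>opnorm\<close> were 0, division by zero would give
    \<open>\<gamma> = 0\<close>, against \<open>\<gamma> > 0\<close>. The locale's product form of
    the step size condition then follows.\<close>
  then have "opnorm \<noteq> 0"
    using \<open>\<gamma> > 0\<close> by auto
  then have "\<gamma> * opnorm\<^sup>2 = \<mu>"
    by (simp add: \<gamma>)
  interpret prob_space M by fact
  interpret random_rbcd X A y y\<^sub>\<delta> \<delta> \<tau> \<mu> \<gamma> M idx x\<^sub>0
    by unfold_locales (use assms \<open>\<gamma> * opnorm\<^sup>2 = \<mu>\<close> in auto)
  have x: "x k \<omega> = iterate k \<omega>" for k \<omega>
    by (simp add: x_def iterate_def)
  obtain v where v: "v \<in> block_space X" "block_op A v = y"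
    using assms(3) by blast
  have "AE \<omega> in M. \<exists>k. norm (block_op A (x k \<omega>) - y\<^sub>\<delta>) \<le> \<tau> * \<delta>"
    using AE_terminates[OF \<open>\<mu> < 2\<close> v] by (simp add: x res_def)
  moreover have "(\<integral>\<omega>. (norm (x (Suc k) \<omega> - xbar))\<^sup>2 \<partial>M)
      \<le> (\<integral>\<omega>. (norm (x k \<omega> - xbar))\<^sup>2 \<partial>M)
        - (2 - 2 / \<tau> - \<mu>) / real CARD('n) *
          (\<integral>\<omega>. discrepancy_step \<gamma> \<tau> \<delta> (block_op A (x k \<omega>) - y\<^sub>\<delta>)
            * (norm (block_op A (x k \<omega>) - y\<^sub>\<delta>))\<^sup>2 \<partial>M)"
    if "xbar \<in> block_space X" "block_op A xbar = y" for xbar k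
    using expectation_decrease[OF sum_error_step[OF _ that], of k] by (simp add: x stepsize_def res_def)
  ultimately show ?thesis
    by (simp add: Let_def)
qed

end
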